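(* Let $\mathcal{H}$ be a finite-dimensional real Hilbert space, and let $P_1$ and $P_2$ be the projection operators onto nonempty closed convex subsets $C_1$ and $C_2$ of $\mathcal{H}$, respectively. Set $T=\frac12(P_1+P_2)$ and suppose that $$\operatorname{Fix}T=S=\operatorname{Argmin}\Phi\neq\varnothing,\quad\text{where}\quad\Phi=\frac14\big(d_{C_1}^2+d_{C_2}^2\big).$$ Let $y_0\in\mathcal{H}$ and let $\overline{x}\in S$ be the limit, as $t\to+\infty$, of the solution $x$ of the Cauchy problem $$x'(t)+x(t)=\tfrac12\big(P_1x(t)+P_2x(t)\big)\ \text{ on }\ ]0,+\infty[,\qquad x(0)=y_0.$$ For every $\varepsilon\in\,]0,1[$, let $x_1^{\varepsilon}=\lim_{k\to+\infty}y_{2k+1}^{\varepsilon}$ and $x_2^{\varepsilon}=\lim_{k\to+\infty}y_{2k+2}^{\varepsilon}$, where $y_0^{\varepsilon}=y_0$ and, for every $k\in\mathbb{N}$, $$y_{2k+1}^{\varepsilon}=\big(\operatorname{Id}+\varepsilon(P_1-\operatorname{Id})\big)y_{2k}^{\varepsilon},\qquad y_{2k+2}^{\varepsilon}=\big(\operatorname{Id}+\varepsilon(P_2-\operatorname{Id})\big)y_{2k+1}^{\varepsilon}.$$ Then $x_1^{\varepsilon}\to\overline{x}$ and $x_2^{\varepsilon}\to\overline{x}$ as $\varepsilon\to0$.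
   Context: $\operatorname{Id}$ is the identity operator, $\operatorname{Fix}$ denotes the set of fixed points, $d_C$ is the distance function to the nonempty closed convex set $C$, and $\operatorname{Argmin}\Phi$ is the set of global minimizers of $\Phi$ over $\mathcal{H}$. The limits $\overline{x}$, $x_1^{\varepsilon}$, $x_2^{\varepsilon}$ are known to exist under these hypotheses. *)

theory Defs
  imports "HOL-Analysis.Analysis"
begin

definition Fix :: "('a \<Rightarrow> 'a) \<Rightarrow> 'a set" where
  "Fix T = {x. T x = x}"

definition Argmin :: "('a \<Rightarrow> real) \<Rightarrow> 'a set" where
  "Argmin f = {x. is_arg_min f (\<lambda>_. True) x}"

text \<open>
  Besides the differential equation on the open half-line, a solution has to be continuous on the
  closed half-line; otherwise the initial value would not constrain it.
\<close>

definition solves_cauchy :: "('a \<Rightarrow> 'a) \<Rightarrow> 'a \<Rightarrow> (real \<Rightarrow> 'a::real_normed_vector) \<Rightarrow> bool" where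
  "solves_cauchy T y0 x \<longleftrightarrow>
     continuous_on {0..} x \<and> x 0 = y0 \<and>
     (\<forall>t>0. \<exists>x'. (x has_vector_derivative x') (at t) \<and> x' + x t = T (x t))"

end

theory Submission
  imports Defs
begin

text \<open>
  Write \<open>F\<^sub>\<epsilon>\<close> for one full cycle of under-relaxed projections. Two facts force its iterates from
  \<open>y0\<close> to settle near the limit of the trajectory.

  The cycle is a step of size \<open>2 * \<epsilon>\<close> of the Euler scheme for \<open>x' = T x - x\<close>, up to an
  error of order \<open>\<epsilon>\<^sup>2\<close> (\<open>cycle_local_error\<close>). Because \<open>F\<^sub>\<epsilon>\<close> is nonexpansive, local errors
  add up without amplification, so on a bounded time interval the iterates shadow the trajectory
  within order \<open>\<epsilon>\<close> (\<open>cycle_shadows_trajectory\<close>). Following it for a long but fixed time brings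
  them near its limit.

  Afterwards they cannot leave again: the distance of the iterates to any fixed point of \<open>F\<^sub>\<epsilon>\<close>
  never increases, and the limit of the trajectory, being a fixed point of \<open>T\<close>, is itself a limit
  of such fixed points as \<open>\<epsilon>\<close> tends to \<open>0\<close>. Indeed, if \<open>u\<close> is the midpoint of its projections
  \<open>p1\<close> and \<open>p2\<close>, then every point of the segment between \<open>p1\<close> and \<open>p2\<close> still projects onto
  \<open>p1\<close> and \<open>p2\<close>, and so the cycle acts on that segment as an affine map, whose fixed point
  tends to \<open>u\<close>
  (\<open>midpoint_gives_fixed_point_of_cycle\<close>).

  This settles \<open>x2\<close>, the limits after full cycles. The first half of a cycle moves a point by
  \<open>\<epsilon>\<close> times its distance to the first set; along \<open>x2\<close> this vanishes with \<open>\<epsilon>\<close>, so \<open>x1\<close> and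
  \<open>x2\<close> tend to the same point.
\<close>

section \<open>Under-relaxed cycles of nonexpansive operators\<close>

definition relax :: "real \<Rightarrow> ('a \<Rightarrow> 'a) \<Rightarrow> 'a \<Rightarrow> 'a::real_normed_vector" where
  "relax \<epsilon> P z = z + \<epsilon> *\<^sub>R (P z - z)"

definition cycle :: "real \<Rightarrow> ('a \<Rightarrow> 'a) \<Rightarrow> ('a \<Rightarrow> 'a) \<Rightarrow> 'a \<Rightarrow> 'a::real_normed_vector" where
  "cycle \<epsilon> P1 P2 z = relax \<epsilon> P2 (relax \<epsilon> P1 z)"

definition nonexpansive :: "('a \<Rightarrow> 'a::real_normed_vector) \<Rightarrow> bool" where
  "nonexpansive P \<longleftrightarrow> (\<forall>u v. norm (P u - P v) \<le> norm (u - v))"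

lemma nonexpansiveD: "nonexpansive P \<Longrightarrow> norm (P u - P v) \<le> norm (u - v)"
  by (simp add: nonexpansive_def)

lemma nonexpansive_imp_continuous_on:
  assumes "nonexpansive P"
  shows "continuous_on A P"
proof -
  have "1-lipschitz_on A P"
    using assms by (auto intro!: lipschitz_onI simp: nonexpansive_def dist_norm)
  thus ?thesis by (rule lipschitz_on_continuous_on)
qed

lemma nonexpansive_compose:
  assumes "nonexpansive P" "nonexpansive Q"
  shows "nonexpansive (\<lambda>z. Q (P z))"
  using assms unfolding nonexpansive_def by (meson order_trans)

lemma nonexpansive_funpow:
  assumes "nonexpansive P"
  shows "nonexpansive (P ^^ k)"
proof (induction k)
  case 0
  thus ?case by (simp add: nonexpansive_def)
next
  case (Suc k)
  thus ?case using nonexpansive_compose[OF Suc assms] by (simp add: comp_def)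
qed

lemma funpow_fixpoint: "f z = z \<Longrightarrow> (f ^^ k) z = z"
  by (induction k) auto

lemma nonexpansive_relax:
  assumes "nonexpansive P" "0 \<le> \<epsilon>" "\<epsilon> \<le> 1"
  shows "nonexpansive (relax \<epsilon> P)"
  unfolding nonexpansive_def
proof (intro allI)
  fix u v
  have "relax \<epsilon> P u - relax \<epsilon> P v = (1 - \<epsilon>) *\<^sub>R (u - v) + \<epsilon> *\<^sub>R (P u - P v)"
    by (simp add: relax_def algebra_simps)
  also have "norm \<dots> \<le> (1 - \<epsilon>) * norm (u - v) + \<epsilon> * norm (P u - P v)"
    using assms by (intro norm_triangle_le) simp
  also have "\<dots> \<le> (1 - \<epsilon>) * norm (u - v) + \<epsilon> * norm (u - v)"
    using nonexpansiveD[OF assms(1)] assms(2) by (intro add_left_mono mult_left_mono) auto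
  also have "\<dots> = norm (u - v)" by (simp add: algebra_simps)
  finally show "norm (relax \<epsilon> P u - relax \<epsilon> P v) \<le> norm (u - v)" .
qed

lemma nonexpansive_cycle:
  assumes "nonexpansive P1" "nonexpansive P2" "0 \<le> \<epsilon>" "\<epsilon> \<le> 1"
  shows "nonexpansive (cycle \<epsilon> P1 P2)"
  unfolding cycle_def
  by (rule nonexpansive_compose[OF nonexpansive_relax[OF assms(1,3,4)] nonexpansive_relax[OF assms(2-4)]])

lemma displacement_lipschitz:
  assumes "nonexpansive P"
  shows "norm ((P u - u) - (P v - v)) \<le> 2 * norm (u - v)"
proof -
  have "norm ((P u - u) - (P v - v)) = norm ((P u - P v) - (u - v))"
    by (simp add: algebra_simps)
  also have "\<dots> \<le> norm (P u - P v) + norm (u - v)" by (rule norm_triangle_ineq4)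
  also have "\<dots> \<le> 2 * norm (u - v)" using nonexpansiveD[OF assms, of u v] by simp
  finally show ?thesis .
qed

lemma nonexpansive_average:
  assumes "nonexpansive P1" "nonexpansive P2"
  shows "nonexpansive (\<lambda>z. (1/2) *\<^sub>R (P1 z + P2 z))"
  unfolding nonexpansive_def
proof (intro allI)
  fix u v
  have "(1/2) *\<^sub>R (P1 u + P2 u) - (1/2) *\<^sub>R (P1 v + P2 v)
      = (1/2) *\<^sub>R ((P1 u - P1 v) + (P2 u - P2 v))" by (simp add: algebra_simps)
  moreover have "norm ((P1 u - P1 v) + (P2 u - P2 v)) \<le> norm (u - v) + norm (u - v)"
    using assms by (intro norm_triangle_mono nonexpansiveD)
  ultimately show "norm ((1/2) *\<^sub>R (P1 u + P2 u) - (1/2) *\<^sub>R (P1 v + P2 v)) \<le> norm (u - v)"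
    by (simp only: norm_scaleR)
qed

text \<open>
  The second relaxation evaluates its displacement not at \<open>z\<close> but at a point at distance
  \<open>\<epsilon> * norm (P1 z - z)\<close> from \<open>z\<close>; this is the only discrepancy with an explicit Euler step.
\<close>
lemma cycle_close_to_Euler_step:
  assumes "nonexpansive P2" "0 \<le> \<epsilon>"
  shows "norm (cycle \<epsilon> P1 P2 z - (z + (2 * \<epsilon>) *\<^sub>R ((1/2) *\<^sub>R (P1 z + P2 z) - z)))
         \<le> 2 * \<epsilon>\<^sup>2 * norm (P1 z - z)"
proof -
  define w where "w = relax \<epsilon> P1 z"
  have "(2 * \<epsilon>) *\<^sub>R z = \<epsilon> *\<^sub>R z + \<epsilon> *\<^sub>R z"
    by (simp flip: scaleR_add_left)
  hence "cycle \<epsilon> P1 P2 z - (z + (2 * \<epsilon>) *\<^sub>R ((1/2) *\<^sub>R (P1 z + P2 z) - z))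
      = \<epsilon> *\<^sub>R ((P2 w - w) - (P2 z - z))"
    by (simp add: cycle_def w_def[symmetric]) (simp add: w_def relax_def algebra_simps)
  hence "norm (cycle \<epsilon> P1 P2 z - (z + (2 * \<epsilon>) *\<^sub>R ((1/2) *\<^sub>R (P1 z + P2 z) - z)))
      = \<epsilon> * norm ((P2 w - w) - (P2 z - z))"
    using assms(2) by (metis norm_scaleR abs_of_nonneg)
  also have "\<dots> \<le> \<epsilon> * (2 * (\<epsilon> * norm (P1 z - z)))"
    using displacement_lipschitz[OF assms(1), of w z] assms(2)
    by (intro mult_left_mono) (simp_all add: w_def relax_def)
  finally show ?thesis by (simp add: power2_eq_square mult_ac)
qed

section \<open>Shadowing the continuous trajectory\<close>

text \<open>
  Along the trajectory the velocity is bounded by \<open>M\<close> and is a \<open>2\<close>-Lipschitz function of the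
  position, so it changes by at most \<open>2 * M * h\<close> over a time \<open>h\<close>; the mean value inequality
  turns this into a bound on the deviation from the tangent.
\<close>
lemma trajectory_close_to_Euler_step:
  fixes x :: "real \<Rightarrow> 'a::real_inner"
  assumes T: "nonexpansive T" and sol: "solves_cauchy T y0 x"
    and s: "0 \<le> s" "0 < h"
    and M: "\<And>r. r \<in> {s..s+h} \<Longrightarrow> norm (T (x r) - x r) \<le> M"
  shows "norm (x (s + h) - (x s + h *\<^sub>R (T (x s) - x s))) \<le> 2 * M * h\<^sup>2"
proof -
  have cont: "continuous_on {s..r} x" for r
    using sol s by (auto simp: solves_cauchy_def intro: continuous_on_subset)
  have der: "(x has_derivative (\<lambda>d. d *\<^sub>R (T (x r) - x r))) (at r)" if r: "0 < r" for r
  proof -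
    obtain x' where "(x has_vector_derivative x') (at r)" "x' + x r = T (x r)"
      using sol r unfolding solves_cauchy_def by blast
    moreover from this(2) have "x' = T (x r) - x r" by (simp add: algebra_simps)
    ultimately show ?thesis by (simp add: has_vector_derivative_def)
  qed
  have M0: "0 \<le> M" using s by (intro order_trans[OF norm_ge_zero M[of s]]) auto
  have speed: "norm (x r - x s) \<le> h * M" if r: "s < r" "r \<le> s + h" for r
  proof -
    obtain q where q: "q \<in> {s<..<r}"
      "norm (x r - x s) \<le> norm ((r - s) *\<^sub>R (T (x q) - x q))"
      using mvt_general[OF r(1) cont, of "\<lambda>q d. d *\<^sub>R (T (x q) - x q)"] der s by auto
    have "norm ((r - s) *\<^sub>R (T (x q) - x q)) \<le> h * M"
      using r q M[of q] s by (auto intro!: mult_mono)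
    with q(2) show ?thesis by linarith
  qed
  define g where "g = (\<lambda>r. x r - r *\<^sub>R (T (x s) - x s))"
  have "continuous_on {s..s+h} g"
    unfolding g_def by (intro continuous_intros cont)
  moreover have "(g has_derivative
      (\<lambda>d. d *\<^sub>R (T (x r) - x r) - d *\<^sub>R (T (x s) - x s))) (at r)" if "0 < r" for r
    unfolding g_def using der[OF that] by (auto intro!: derivative_eq_intros)
  ultimately obtain r where r: "r \<in> {s<..<s+h}"
    "norm (g (s + h) - g s) \<le> norm (h *\<^sub>R (T (x r) - x r) - h *\<^sub>R (T (x s) - x s))"
    using mvt_general[of s "s+h" g "\<lambda>r d. d *\<^sub>R (T (x r) - x r) - d *\<^sub>R (T (x s) - x s)"] s
    by auto
  have "norm (h *\<^sub>R (T (x r) - x r) - h *\<^sub>R (T (x s) - x s))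
      = h * norm ((T (x r) - x r) - (T (x s) - x s))"
    using s by (simp flip: scaleR_diff_right)
  also have "\<dots> \<le> h * (2 * (h * M))"
    using displacement_lipschitz[OF T, of "x r" "x s"] speed[of r] r(1) s
    by (intro mult_left_mono) auto
  finally have "norm (g (s + h) - g s) \<le> 2 * M * h\<^sup>2"
    using r(2) by (simp add: power2_eq_square algebra_simps)
  moreover have "g (s + h) - g s = x (s + h) - (x s + h *\<^sub>R (T (x s) - x s))"
    by (simp add: g_def algebra_simps)
  ultimately show ?thesis by simp
qed

lemma cycle_local_error:
  fixes x :: "real \<Rightarrow> 'a::real_inner"
  assumes P: "nonexpansive P1" "nonexpansive P2"
    and sol: "solves_cauchy (\<lambda>z. (1/2) *\<^sub>R (P1 z + P2 z)) y0 x"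
    and s: "0 \<le> s" "0 < \<epsilon>"
    and M: "\<And>r. r \<in> {s..s+2*\<epsilon>} \<Longrightarrow> norm (P1 (x r) - x r) \<le> M"
      "\<And>r. r \<in> {s..s+2*\<epsilon>} \<Longrightarrow> norm ((1/2) *\<^sub>R (P1 (x r) + P2 (x r)) - x r) \<le> M"
  shows "norm (x (s + 2 * \<epsilon>) - cycle \<epsilon> P1 P2 (x s)) \<le> 10 * M * \<epsilon>\<^sup>2"
proof -
  let ?e = "x s + (2 * \<epsilon>) *\<^sub>R ((1/2) *\<^sub>R (P1 (x s) + P2 (x s)) - x s)"
  have "norm (x (s + 2 * \<epsilon>) - ?e) \<le> 2 * M * (2 * \<epsilon>)\<^sup>2"
    using s by (intro trajectory_close_to_Euler_step[OF nonexpansive_average[OF P] sol] M) auto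
  moreover have "norm (cycle \<epsilon> P1 P2 (x s) - ?e) \<le> 2 * \<epsilon>\<^sup>2 * norm (P1 (x s) - x s)"
    using s by (intro cycle_close_to_Euler_step[OF P(2)]) auto
  moreover have "2 * \<epsilon>\<^sup>2 * norm (P1 (x s) - x s) \<le> 2 * \<epsilon>\<^sup>2 * M"
    using s by (intro mult_left_mono M) auto
  moreover have "norm (x (s + 2 * \<epsilon>) - cycle \<epsilon> P1 P2 (x s))
      \<le> norm (x (s + 2 * \<epsilon>) - ?e) + norm (cycle \<epsilon> P1 P2 (x s) - ?e)"
    using norm_triangle_ineq4[of "x (s + 2 * \<epsilon>) - ?e" "cycle \<epsilon> P1 P2 (x s) - ?e"] by simp
  ultimately show ?thesis by (simp add: power_mult_distrib algebra_simps)
qed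

text \<open>
  Nonexpansiveness makes the global error at most the sum of the local ones: \<open>k\<close> steps of order
  \<open>\<epsilon>\<^sup>2\<close> with \<open>2 * \<epsilon> * k \<le> \<tau>\<close>, hence an error of order \<open>\<epsilon>\<close>.
\<close>
lemma cycle_shadows_trajectory:
  fixes x :: "real \<Rightarrow> 'a::real_inner"
  assumes P: "nonexpansive P1" "nonexpansive P2"
    and sol: "solves_cauchy (\<lambda>z. (1/2) *\<^sub>R (P1 z + P2 z)) y0 x"
  obtains C where "\<And>\<epsilon> k. 0 < \<epsilon> \<Longrightarrow> \<epsilon> \<le> 1 \<Longrightarrow> 2 * \<epsilon> * real k \<le> \<tau> \<Longrightarrow>
    norm (x (2 * \<epsilon> * real k) - (cycle \<epsilon> P1 P2 ^^ k) y0) \<le> C * \<epsilon>"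
proof -
  let ?T = "\<lambda>z. (1/2) *\<^sub>R (P1 z + P2 z)"
  have bdd: "\<exists>M. \<forall>r\<in>{0..\<tau>}. norm (Q (x r) - x r) \<le> M" if Q: "nonexpansive Q" for Q
  proof -
    have cx: "continuous_on {0..\<tau>} x"
      using sol by (auto simp: solves_cauchy_def intro: continuous_on_subset)
    have "continuous_on {0..\<tau>} (\<lambda>r. Q (x r))"
      by (rule continuous_on_compose2[OF nonexpansive_imp_continuous_on[OF Q, of UNIV] cx]) auto
    hence "bounded ((\<lambda>r. Q (x r) - x r) ` {0..\<tau>})"
      by (intro compact_imp_bounded compact_continuous_image continuous_intros cx) auto
    thus ?thesis by (simp add: bounded_iff)
  qed
  obtain M1 where M1: "\<And>r. r \<in> {0..\<tau>} \<Longrightarrow> norm (P1 (x r) - x r) \<le> M1"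
    using bdd[OF P(1)] by blast
  obtain M2 where M2: "\<And>r. r \<in> {0..\<tau>} \<Longrightarrow> norm (?T (x r) - x r) \<le> M2"
    using bdd[OF nonexpansive_average[OF P]] by blast
  define M where "M = max 0 (max M1 M2)"
  have M: "norm (P1 (x r) - x r) \<le> M" "norm (?T (x r) - x r) \<le> M" if "r \<in> {0..\<tau>}" for r
    using M1[OF that] M2[OF that] by (auto simp: M_def)
  have M0: "0 \<le> M" by (simp add: M_def)
  have acc: "norm (x (2 * \<epsilon> * real k) - (cycle \<epsilon> P1 P2 ^^ k) y0) \<le> real k * (10 * M * \<epsilon>\<^sup>2)"
    if e: "0 < \<epsilon>" "\<epsilon> \<le> 1" and "2 * \<epsilon> * real k \<le> \<tau>" for \<epsilon> k
    using that(3)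
  proof (induction k)
    case 0
    thus ?case using sol by (simp add: solves_cauchy_def)
  next
    case (Suc k)
    let ?F = "cycle \<epsilon> P1 P2" and ?s = "2 * \<epsilon> * real k"
    have le: "?s + 2 * \<epsilon> \<le> \<tau>" using Suc.prems by (simp add: algebra_simps)
    have s0: "0 \<le> ?s" using e by simp
    have "norm (?F (x ?s) - ?F ((?F ^^ k) y0)) \<le> norm (x ?s - (?F ^^ k) y0)"
      using e by (intro nonexpansiveD nonexpansive_cycle P) auto
    also have "\<dots> \<le> real k * (10 * M * \<epsilon>\<^sup>2)"
      using le e by (intro Suc.IH) auto
    finally have "norm (?F (x ?s) - ?F ((?F ^^ k) y0)) \<le> real k * (10 * M * \<epsilon>\<^sup>2)" .
    moreover have "norm (x (?s + 2 * \<epsilon>) - ?F (x ?s)) \<le> 10 * M * \<epsilon>\<^sup>2"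
    proof (rule cycle_local_error[OF P sol s0 e(1)])
      fix r assume "r \<in> {?s..?s + 2 * \<epsilon>}"
      hence "?s \<le> r" "r \<le> ?s + 2 * \<epsilon>" by simp_all
      hence "0 \<le> r" "r \<le> \<tau>" using le s0 by linarith+
      hence "r \<in> {0..\<tau>}" by simp
      thus "norm (P1 (x r) - x r) \<le> M" "norm (?T (x r) - x r) \<le> M" by (rule M)+
    qed
    ultimately have "norm (x (?s + 2 * \<epsilon>) - ?F ((?F ^^ k) y0))
        \<le> 10 * M * \<epsilon>\<^sup>2 + real k * (10 * M * \<epsilon>\<^sup>2)"
      using norm_triangle_ineq[of "x (?s + 2 * \<epsilon>) - ?F (x ?s)" "?F (x ?s) - ?F ((?F ^^ k) y0)"]
      by simp
    moreover have "?s + 2 * \<epsilon> = 2 * \<epsilon> * real (Suc k)" by (simp add: algebra_simps)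
    ultimately show ?case by (simp add: algebra_simps)
  qed
  show thesis
  proof (rule that[of "5 * M * \<tau>"])
    fix \<epsilon> :: real and k :: nat
    assume e: "0 < \<epsilon>" "\<epsilon> \<le> 1" "2 * \<epsilon> * real k \<le> \<tau>"
    have "real k * (10 * M * \<epsilon>\<^sup>2) = (5 * M * \<epsilon>) * (2 * \<epsilon> * real k)"
      by (simp add: power2_eq_square)
    also have "\<dots> \<le> (5 * M * \<epsilon>) * \<tau>"
      using e M0 by (intro mult_left_mono) auto
    finally show "norm (x (2 * \<epsilon> * real k) - (cycle \<epsilon> P1 P2 ^^ k) y0) \<le> 5 * M * \<tau> * \<epsilon>"
      using acc[OF e] by (simp add: mult_ac)
  qed
qed

text \<open>
  A fixed point of each cycle close to \<open>u\<close> acts as an anchor: once the iterates have followed the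
  trajectory into a small ball around \<open>u\<close>, nonexpansiveness keeps them in a slightly larger one.
\<close>
lemma cycle_limits_tendsto_trajectory_limit:
  fixes x :: "real \<Rightarrow> 'a::real_inner"
  assumes P: "nonexpansive P1" "nonexpansive P2"
    and sol: "solves_cauchy (\<lambda>z. (1/2) *\<^sub>R (P1 z + P2 z)) y0 x"
    and x: "(x \<longlongrightarrow> u) at_top"
    and fixp: "\<And>\<epsilon>. \<epsilon> \<in> {0<..<1} \<Longrightarrow> cycle \<epsilon> P1 P2 (z \<epsilon>) = z \<epsilon>"
    and z: "(z \<longlongrightarrow> u) (at_right 0)"
    and lim: "\<And>\<epsilon>. \<epsilon> \<in> {0<..<1} \<Longrightarrow> (\<lambda>k. (cycle \<epsilon> P1 P2 ^^ k) y0) \<longlonglongrightarrow> l \<epsilon>"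
  shows "(l \<longlongrightarrow> u) (at_right 0)"
proof (rule tendstoI)
  fix d :: real assume d: "0 < d"
  define \<delta> where "\<delta> = d / 5"
  have \<delta>: "0 < \<delta>" using d by (simp add: \<delta>_def)
  obtain \<tau>0 where \<tau>0: "\<And>t. t \<ge> \<tau>0 \<Longrightarrow> dist (x t) u < \<delta>"
    using tendstoD[OF x \<delta>] unfolding eventually_at_top_linorder by blast
  define \<tau> where "\<tau> = max 0 \<tau>0"
  \<comment> \<open>The extra \<open>2\<close> leaves room for rounding \<open>\<tau>\<close> up to a multiple of the step \<open>2 * \<epsilon>\<close>.\<close>
  obtain C where C: "\<And>\<epsilon> k. 0 < \<epsilon> \<Longrightarrow> \<epsilon> \<le> 1 \<Longrightarrow> 2 * \<epsilon> * real k \<le> \<tau> + 2 \<Longrightarrow>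
      norm (x (2 * \<epsilon> * real k) - (cycle \<epsilon> P1 P2 ^^ k) y0) \<le> C * \<epsilon>"
    using cycle_shadows_trajectory[OF P sol, where \<tau> = "\<tau> + 2"] by blast
  have "((\<lambda>\<epsilon>. C * \<epsilon>) \<longlongrightarrow> C * 0) (at_right 0)"
    by (intro tendsto_intros)
  hence "eventually (\<lambda>\<epsilon>. C * \<epsilon> < \<delta>) (at_right 0)"
    using \<delta> by (auto dest: order_tendstoD(2))
  moreover have "eventually (\<lambda>\<epsilon>. dist (z \<epsilon>) u < \<delta>) (at_right 0)"
    by (rule tendstoD[OF z \<delta>])
  moreover have "eventually (\<lambda>\<epsilon>::real. \<epsilon> \<in> {0<..<1}) (at_right 0)"
    by (rule eventually_at_right_real) simp
  ultimately show "eventually (\<lambda>\<epsilon>. dist (l \<epsilon>) u < d) (at_right 0)"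
  proof eventually_elim
    case (elim \<epsilon>)
    hence e: "0 < \<epsilon>" "\<epsilon> \<le> 1" by auto
    let ?F = "cycle \<epsilon> P1 P2"
    define k where "k = nat \<lceil>\<tau> / (2 * \<epsilon>)\<rceil>"
    have "0 \<le> \<tau> / (2 * \<epsilon>)" using e by (simp add: \<tau>_def)
    hence "\<tau> / (2 * \<epsilon>) \<le> real k" "real k < \<tau> / (2 * \<epsilon>) + 1"
      unfolding k_def by linarith+
    hence k: "\<tau> \<le> 2 * \<epsilon> * real k" "2 * \<epsilon> * real k \<le> \<tau> + 2 * \<epsilon>"
      using e by (simp_all add: field_simps)
    have "norm (x (2 * \<epsilon> * real k) - (?F ^^ k) y0) \<le> C * \<epsilon>"
      using k e by (intro C) auto
    moreover have "dist (x (2 * \<epsilon> * real k)) u < \<delta>"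
      using k(1) by (intro \<tau>0) (simp add: \<tau>_def)
    ultimately have near: "dist ((?F ^^ k) y0) (z \<epsilon>) \<le> 3 * \<delta>"
      using elim(1,2) dist_triangle[of "(?F ^^ k) y0" "z \<epsilon>" u]
        dist_triangle[of "(?F ^^ k) y0" u "x (2 * \<epsilon> * real k)"]
      by (simp add: dist_norm norm_minus_commute)
    have stay: "dist ((?F ^^ (j + k)) y0) (z \<epsilon>) \<le> 3 * \<delta>" for j
    proof -
      have "nonexpansive (?F ^^ j)"
        using e by (intro nonexpansive_funpow nonexpansive_cycle P) auto
      from nonexpansiveD[OF this, of "(?F ^^ k) y0" "z \<epsilon>"] near
      show ?thesis
        by (simp add: funpow_add funpow_fixpoint[of ?F, OF fixp[OF elim(3)]] dist_norm)
    qed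
    have "(\<lambda>j. (?F ^^ (j + k)) y0) \<longlonglongrightarrow> l \<epsilon>"
      by (rule LIMSEQ_ignore_initial_segment[OF lim[OF elim(3)]])
    hence "(\<lambda>j. dist ((?F ^^ (j + k)) y0) (z \<epsilon>)) \<longlonglongrightarrow> dist (l \<epsilon>) (z \<epsilon>)"
      by (intro tendsto_dist tendsto_const)
    hence "dist (l \<epsilon>) (z \<epsilon>) \<le> 3 * \<delta>"
      by (rule LIMSEQ_le_const2) (use stay in blast)
    thus ?case
      using elim(2) dist_triangle[of "l \<epsilon>" u "z \<epsilon>"] d by (simp add: \<delta>_def)
  qed
qed

section \<open>Fixed points of a cycle of two under-relaxed projections\<close>

lemma nonexpansive_closest_point:
  fixes C :: "'a::euclidean_space set"
  assumes "convex C" "closed C" "C \<noteq> {}"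
  shows "nonexpansive (closest_point C)"
  using closest_point_lipschitz[OF assms] by (simp add: nonexpansive_def dist_norm)

text \<open>
  The normal cone of \<open>C\<close> at \<open>p\<close>, which consists of the displacements of the points that project
  onto \<open>p\<close>, is closed under nonnegative scaling.
\<close>
lemma closest_point_on_normal_ray:
  fixes C :: "'a::euclidean_space set"
  assumes C: "convex C" "closed C" "C \<noteq> {}"
    and p: "closest_point C u = p" and t: "0 \<le> t"
  shows "closest_point C (p + t *\<^sub>R (u - p)) = p"
proof (rule closest_point_unique[OF C(1,2), symmetric])
  show "p \<in> C" using closest_point_in_set[OF C(2,3)] p by blast
  show "\<forall>c\<in>C. dist (p + t *\<^sub>R (u - p)) p \<le> dist (p + t *\<^sub>R (u - p)) c"
  proof
    fix c assume "c \<in> C"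
    hence *: "inner (u - p) (c - p) \<le> 0"
      using closest_point_dot[OF C(1,2)] p by blast
    define a b where "a = t *\<^sub>R (u - p)" and "b = c - p"
    have "inner a b \<le> 0"
      using * t by (simp add: a_def b_def mult_nonneg_nonpos)
    hence "inner a a \<le> inner (a - b) (a - b)"
      using inner_ge_zero[of b]
      by (simp add: inner_diff inner_commute[of b a] del: inner_ge_zero)
    hence "norm a \<le> norm (a - b)" by (simp add: norm_le)
    moreover have "p + a - c = a - b" by (simp add: b_def)
    ultimately show "dist (p + t *\<^sub>R (u - p)) p \<le> dist (p + t *\<^sub>R (u - p)) c"
      unfolding a_def[symmetric] by (simp only: dist_norm add_diff_cancel_left')
  qed
qed

lemma relax_towards_image:
  assumes "P (p + c *\<^sub>R d) = p"
  shows "relax \<epsilon> P (p + c *\<^sub>R d) = p + ((1 - \<epsilon>) * c) *\<^sub>R d"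
  by (simp add: relax_def assms left_diff_distrib scaleR_diff_left)

text \<open>
  On the segment between the two projections of \<open>u\<close> both operators are constant, so the fixed
  point equation is linear. The weight \<open>2 / (2 - \<epsilon>)\<close> solves it; it slightly exceeds \<open>1\<close>, that
  is, the fixed point lies a little beyond the midpoint \<open>u\<close>, towards the set projected on last.
\<close>
lemma midpoint_gives_fixed_point_of_cycle:
  fixes C1 C2 :: "'a::euclidean_space set"
  assumes C1: "convex C1" "closed C1" "C1 \<noteq> {}" and C2: "convex C2" "closed C2" "C2 \<noteq> {}"
    and mid: "(1/2) *\<^sub>R (closest_point C1 u + closest_point C2 u) = u"
    and e: "\<epsilon> \<in> {0<..<1}"
    and p: "p = closest_point C1 u"
  shows "cycle \<epsilon> (closest_point C1) (closest_point C2) (p + (2 / (2 - \<epsilon>)) *\<^sub>R (u - p))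
         = p + (2 / (2 - \<epsilon>)) *\<^sub>R (u - p)"
proof -
  define q where "q = closest_point C2 u"
  define c where "c = 2 / (2 - \<epsilon>)"
  have c: "0 \<le> c" "(2 - \<epsilon>) * c = 2" using e by (auto simp: c_def field_simps)
  have c': "(1 - \<epsilon>) * c = 2 - c" using c(2) by (simp add: algebra_simps)
  have "p + q = 2 *\<^sub>R ((1/2) *\<^sub>R (p + q))" by simp
  also have "\<dots> = 2 *\<^sub>R u" using mid p by (simp only: q_def)
  also have "\<dots> = u + u" by (simp add: scaleR_2)
  finally have opposite: "u - q = - (u - p)"
    by (metis add.commute add_diff_cancel_right' diff_diff_eq2 minus_diff_eq)
  \<comment> \<open>The normal rays at \<open>p\<close> and \<open>q\<close> run through each other's base point, in opposite directions
    and at parameter \<open>2\<close>; so parameter \<open>2 - c\<close> on one is parameter \<open>c\<close> on the other.\<close>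
  have swap: "r' + (2 - c) *\<^sub>R - d = r + c *\<^sub>R d" if "r' - r = 2 *\<^sub>R d" for r r' d :: 'a
  proof -
    have "r' = r + 2 *\<^sub>R d" using that by (metis add.commute diff_add_cancel)
    thus ?thesis by (simp add: scaleR_diff_left)
  qed
  have qp: "q - p = 2 *\<^sub>R (u - p)"
  proof -
    have "q - p = (u - p) - (u - q)" by simp
    thus ?thesis by (simp only: opposite) (simp add: scaleR_2)
  qed
  let ?z = "p + c *\<^sub>R (u - p)" and ?w = "q + c *\<^sub>R (u - q)"
  have "relax \<epsilon> (closest_point C1) ?z = p + (2 - c) *\<^sub>R (u - p)"
    using relax_towards_image closest_point_on_normal_ray[OF C1 p[symmetric] c(1)] c'
    by metis
  also have "\<dots> = p + (2 - c) *\<^sub>R - (u - q)"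
    by (simp only: opposite minus_minus)
  also have "\<dots> = ?w"
  proof (rule swap)
    show "p - q = 2 *\<^sub>R (u - q)"
      using qp by (simp only: opposite scaleR_minus_right flip: minus_diff_eq[of q p])
  qed
  finally have w: "relax \<epsilon> (closest_point C1) ?z = ?w" .
  have "relax \<epsilon> (closest_point C2) ?w = q + (2 - c) *\<^sub>R (u - q)"
    using relax_towards_image closest_point_on_normal_ray[OF C2 q_def[symmetric] c(1)] c'
    by metis
  also have "\<dots> = ?z"
    unfolding opposite by (rule swap[OF qp])
  finally show ?thesis by (simp only: cycle_def w flip: c_def)
qed

section \<open>Convergence of the limit cycles\<close>

theorem corollary3p5:
  fixes C1 C2 S :: "'a::euclidean_space set"
    and P1 P2 T :: "'a \<Rightarrow> 'a"
    and \<Phi> :: "'a \<Rightarrow> real"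
    and x :: "real \<Rightarrow> 'a"
    and y0 xbar :: 'a
    and y :: "real \<Rightarrow> nat \<Rightarrow> 'a"
    and x1 x2 :: "real \<Rightarrow> 'a"
  assumes "C1 \<noteq> {}" and "closed C1" and "convex C1"
    and "C2 \<noteq> {}" and "closed C2" and "convex C2"
    and "P1 = closest_point C1" and "P2 = closest_point C2"
    and "T = (\<lambda>z. (1/2) *\<^sub>R (P1 z + P2 z))"
    and "\<Phi> = (\<lambda>z. (1/4) * ((infdist z C1)\<^sup>2 + (infdist z C2)\<^sup>2))"
    and "Fix T = S" and "S = Argmin \<Phi>" and "S \<noteq> {}"
    and "solves_cauchy (\<lambda>z. (1/2) *\<^sub>R (P1 z + P2 z)) y0 x"
    and "xbar \<in> S" and "(x \<longlongrightarrow> xbar) at_top"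
    and "\<And>\<epsilon>. \<epsilon> \<in> {0<..<1} \<Longrightarrow> y \<epsilon> 0 = y0"
    and "\<And>\<epsilon> k. \<epsilon> \<in> {0<..<1} \<Longrightarrow>
           y \<epsilon> (2*k + 1) = y \<epsilon> (2*k) + \<epsilon> *\<^sub>R (P1 (y \<epsilon> (2*k)) - y \<epsilon> (2*k))"
    and "\<And>\<epsilon> k. \<epsilon> \<in> {0<..<1} \<Longrightarrow>
           y \<epsilon> (2*k + 2) = y \<epsilon> (2*k + 1) + \<epsilon> *\<^sub>R (P2 (y \<epsilon> (2*k + 1)) - y \<epsilon> (2*k + 1))"
    and "\<And>\<epsilon>. \<epsilon> \<in> {0<..<1} \<Longrightarrow> (\<lambda>k. y \<epsilon> (2*k + 1)) \<longlonglongrightarrow> x1 \<epsilon>"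
    and "\<And>\<epsilon>. \<epsilon> \<in> {0<..<1} \<Longrightarrow> (\<lambda>k. y \<epsilon> (2*k + 2)) \<longlonglongrightarrow> x2 \<epsilon>"
  shows "(x1 \<longlongrightarrow> xbar) (at_right 0) \<and> (x2 \<longlongrightarrow> xbar) (at_right 0)"
proof -
  have P: "nonexpansive P1" "nonexpansive P2"
    unfolding \<open>P1 = closest_point C1\<close> \<open>P2 = closest_point C2\<close>
    by (intro nonexpansive_closest_point assms)+
  have mid: "(1/2) *\<^sub>R (P1 xbar + P2 xbar) = xbar"
    using \<open>xbar \<in> S\<close> unfolding \<open>Fix T = S\<close>[symmetric] assms(9) Fix_def by blast
  define z where "z = (\<lambda>\<epsilon>::real. P1 xbar + (2 / (2 - \<epsilon>)) *\<^sub>R (xbar - P1 xbar))"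
  have fixz: "cycle \<epsilon> P1 P2 (z \<epsilon>) = z \<epsilon>" if "\<epsilon> \<in> {0<..<1}" for \<epsilon>
    unfolding z_def \<open>P1 = closest_point C1\<close> \<open>P2 = closest_point C2\<close>
    by (intro midpoint_gives_fixed_point_of_cycle assms refl that
        mid[unfolded \<open>P1 = closest_point C1\<close> \<open>P2 = closest_point C2\<close>])
  have "(z \<longlongrightarrow> P1 xbar + (2 / (2 - 0)) *\<^sub>R (xbar - P1 xbar)) (at_right 0)"
    unfolding z_def by (intro tendsto_intros) auto
  hence z: "(z \<longlongrightarrow> xbar) (at_right 0)" by simp
  have y_odd: "y \<epsilon> (2*k + 1) = relax \<epsilon> P1 (y \<epsilon> (2*k))" if "\<epsilon> \<in> {0<..<1}" for \<epsilon> k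
    using assms(18)[OF that] by (simp add: relax_def)
  have y_even: "y \<epsilon> (2*k) = (cycle \<epsilon> P1 P2 ^^ k) y0" if e: "\<epsilon> \<in> {0<..<1}" for \<epsilon> k
  proof (induction k)
    case 0
    show ?case using assms(17)[OF e] by simp
  next
    case (Suc k)
    have "y \<epsilon> (2 * Suc k) = cycle \<epsilon> P1 P2 (y \<epsilon> (2*k))"
      using assms(19)[OF e, of k] y_odd[OF e, of k] by (simp add: cycle_def relax_def)
    thus ?case using Suc by simp
  qed
  have lim_even: "(\<lambda>k. y \<epsilon> (2*k)) \<longlonglongrightarrow> x2 \<epsilon>" if e: "\<epsilon> \<in> {0<..<1}" for \<epsilon>
    using assms(21)[OF e] LIMSEQ_imp_Suc[of "\<lambda>k. y \<epsilon> (2*k)"] by simp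
  have x2: "(x2 \<longlongrightarrow> xbar) (at_right 0)"
  proof (rule cycle_limits_tendsto_trajectory_limit[OF P assms(14) assms(16) fixz z])
    show "(\<lambda>k. (cycle \<epsilon> P1 P2 ^^ k) y0) \<longlonglongrightarrow> x2 \<epsilon>" if e: "\<epsilon> \<in> {0<..<1}" for \<epsilon>
      using lim_even[OF e] y_even[OF e] by simp
  qed
  have cont1: "isCont P1 v" for v
    using nonexpansive_imp_continuous_on[OF P(1), of UNIV]
    by (simp add: continuous_on_eq_continuous_at)
  have x1_eq: "x1 \<epsilon> = relax \<epsilon> P1 (x2 \<epsilon>)" if e: "\<epsilon> \<in> {0<..<1}" for \<epsilon>
  proof (rule LIMSEQ_unique[OF assms(20)[OF e]])
    show "(\<lambda>k. y \<epsilon> (2*k + 1)) \<longlonglongrightarrow> relax \<epsilon> P1 (x2 \<epsilon>)"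
      unfolding y_odd[OF e] relax_def
      by (intro tendsto_intros lim_even[OF e] isCont_tendsto_compose[OF cont1])
  qed
  have "((\<lambda>\<epsilon>. relax \<epsilon> P1 (x2 \<epsilon>)) \<longlongrightarrow> xbar + 0 *\<^sub>R (P1 xbar - xbar)) (at_right 0)"
    unfolding relax_def by (intro tendsto_intros x2 isCont_tendsto_compose[OF cont1])
  moreover have "eventually (\<lambda>\<epsilon>. relax \<epsilon> P1 (x2 \<epsilon>) = x1 \<epsilon>) (at_right 0)"
    using eventually_at_right_real[OF zero_less_one] by eventually_elim (simp add: x1_eq)
  ultimately have "(x1 \<longlongrightarrow> xbar) (at_right 0)"
    by (simp add: tendsto_cong)
  with x2 show ?thesis by blast
qed

end
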